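(* Every color graph is isomorphic to a vertex-induced subgraph of a (finite-dimensional) hypercube graph.
   Context: Let $V=\mathbb{Z}_2\times\mathbb{Z}_2$ be the Klein four-group with elements $0,1,2,3$ ($1+2+3=0$, $x+x=0$). Color graphs can be described as follows. Let $n\geq 3$ and let $P$ be a convex $n$-gon whose vertices are colored by elements of $V$ so that adjacent polygon vertices have different colors. A triangulation of $P$ (using only the vertices of $P$) is compatible with the coloring if every diagonal of the triangulation joins two differently colored vertices. The color graph of this coloring has as vertices the compatible triangulations, two being adjacent iff they differ by a single diagonal flip (removing one diagonal and inserting the other diagonal of the resulting quadrilateral). (Equivalently, in dual terms: for a color vector ${\bf c}$ of nonzero elements of $V$, the color graph has as vertices the rooted planar binary trees whose leaf edges, colored by ${\bf c}$ from left to right, extend to an edge coloring by $\{1,2,3\}$ with the three colors at each internal vertex summing to $0$, with edges given by rotations; the leaf colors are the sums of the colors of the two polygon vertices nearest each leaf.) For a finite set $S$, the hypercube $\mathcal{H}(S)$ has vertex set the power set of $S$, with $A,B$ adjacent iff the symmetric difference $A\Delta B$ is a singleton. *)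

theory Defs
  imports "Graph_Theory.Graph_Theory" "HOL-Library.Z2" "HOL-Library.Product_Plus"
begin

type_synonym klein = "bit \<times> bit"

lemma klein_add_self: "(x :: klein) + x = 0"
  by (cases x) (simp add: zero_prod_def)

text \<open>
  A convex \<open>n\<close>-gon is represented by its vertices \<open>0, \<dots>, n - 1\<close> in cyclic order, and a segment
  between two distinct vertices by the set of its end points. Because the vertices are in convex
  position, two segments meet in their relative interiors iff their end points interlace.
\<close>

definition polygon_sides :: "nat \<Rightarrow> nat set set" where
  "polygon_sides n = {{i, Suc i mod n} | i. i < n}"

definition diagonals :: "nat \<Rightarrow> nat set set" where
  "diagonals n = {{i, j} | i j. i < n \<and> j < n \<and> i \<noteq> j} - polygon_sides n"

definition crossing :: "nat set \<Rightarrow> nat set \<Rightarrow> bool" where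
  "crossing d e \<longleftrightarrow> (\<exists>p q r s. p < q \<and> q < r \<and> r < s \<and>
     ((d = {p, r} \<and> e = {q, s}) \<or> (d = {q, s} \<and> e = {p, r})))"

definition noncrossing :: "nat set set \<Rightarrow> bool" where
  "noncrossing T \<longleftrightarrow> (\<forall>d \<in> T. \<forall>e \<in> T. \<not> crossing d e)"

text \<open>A triangulation is given by its set of diagonals.\<close>

definition triangulation :: "nat \<Rightarrow> nat set set \<Rightarrow> bool" where
  "triangulation n T \<longleftrightarrow> T \<subseteq> diagonals n \<and> noncrossing T \<and>
     (\<forall>T'. T \<subseteq> T' \<and> T' \<subseteq> diagonals n \<and> noncrossing T' \<longrightarrow> T' = T)"

text \<open>
  \<open>p, q, r, s\<close> is the quadrilateral that results from removing one of its diagonals from the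
  triangulation \<open>T\<close>: each of its sides is a diagonal in \<open>T\<close> or a side of the polygon.
\<close>

definition flip :: "nat \<Rightarrow> nat set set \<Rightarrow> nat set set \<Rightarrow> bool" where
  "flip n T T' \<longleftrightarrow> (\<exists>p q r s. p < q \<and> q < r \<and> r < s \<and> s < n \<and>
     {{p, q}, {q, r}, {r, s}, {s, p}} \<subseteq> T \<union> polygon_sides n \<and>
     (({p, r} \<in> T \<and> T' = insert {q, s} (T - {{p, r}})) \<or>
      ({q, s} \<in> T \<and> T' = insert {p, r} (T - {{q, s}}))))"

definition polygon_coloring :: "nat \<Rightarrow> (nat \<Rightarrow> klein) \<Rightarrow> bool" where
  "polygon_coloring n c \<longleftrightarrow> (\<forall>i < n. c i \<noteq> c (Suc i mod n))"

definition compatible_triangulations :: "nat \<Rightarrow> (nat \<Rightarrow> klein) \<Rightarrow> nat set set set" where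
  "compatible_triangulations n c = {T. triangulation n T \<and> (\<forall>d \<in> T. inj_on c d)}"

text \<open>
  Undirected simple graphs are symmetric, loop-free digraphs without parallel arcs, see
  \<open>pair_graph_color_graph\<close> and \<open>pair_graph_hypercube\<close> below.
\<close>

definition color_graph :: "nat \<Rightarrow> (nat \<Rightarrow> klein) \<Rightarrow> nat set set pair_pre_digraph" where
  "color_graph n c = \<lparr> pverts = compatible_triangulations n c,
     parcs = {(T, T'). T \<in> compatible_triangulations n c \<and> T' \<in> compatible_triangulations n c \<and>
                       flip n T T'} \<rparr>"

definition hypercube :: "'a set \<Rightarrow> 'a set pair_pre_digraph" where
  "hypercube S = \<lparr> pverts = Pow S,
     parcs = {(A, B). A \<subseteq> S \<and> B \<subseteq> S \<and> (\<exists>x. (A - B) \<union> (B - A) = {x})} \<rparr>"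

lemma finite_diagonals: "finite (diagonals n)"
proof (rule finite_subset)
  show "diagonals n \<subseteq> Pow {..<n}" by (auto simp: diagonals_def)
qed simp

lemma finite_compatible_triangulations: "finite (compatible_triangulations n c)"
proof (rule finite_subset)
  show "compatible_triangulations n c \<subseteq> Pow (diagonals n)"
    by (auto simp: compatible_triangulations_def triangulation_def)
qed (simp add: finite_diagonals)

lemma flip_sym_neq:
  assumes T: "noncrossing T" and fl: "flip n T T'"
  shows "flip n T' T" "T \<noteq> T'"
proof -
  from fl obtain p q r s where o: "p < q" "q < r" "r < s" "s < n"
    and sides: "{{p, q}, {q, r}, {r, s}, {s, p}} \<subseteq> T \<union> polygon_sides n"
    and T': "({p, r} \<in> T \<and> T' = insert {q, s} (T - {{p, r}})) \<or>
             ({q, s} \<in> T \<and> T' = insert {p, r} (T - {{q, s}}))"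
    unfolding flip_def by (elim exE conjE) (rule that)
  have "crossing {p, r} {q, s}" using o unfolding crossing_def
    by (intro exI[of _ p] exI[of _ q] exI[of _ r] exI[of _ s]) simp
  with T have nb: "\<not> ({p, r} \<in> T \<and> {q, s} \<in> T)" unfolding noncrossing_def by blast
  have ne: "{p, r} \<notin> {{p, q}, {q, r}, {r, s}, {s, p}}" "{q, s} \<notin> {{p, q}, {q, r}, {r, s}, {s, p}}"
    "{p, r} \<noteq> {q, s}"
    using o by (auto simp: doubleton_eq_iff)
  have neq: "flip n T' T \<and> T \<noteq> T'"
    if e: "d \<in> T" "T' = insert d' (T - {d})" "d' \<notin> T" "d \<noteq> d'"
      "(d = {p, r} \<and> d' = {q, s}) \<or> (d = {q, s} \<and> d' = {p, r})" for d d'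
  proof
    have "d \<notin> {{p, q}, {q, r}, {r, s}, {s, p}}" using e(5) ne by metis
    then have sides': "{{p, q}, {q, r}, {r, s}, {s, p}} \<subseteq> T' \<union> polygon_sides n"
      using sides unfolding e(2) insert_subset by blast
    have "d' \<in> T'" "T = insert d (T' - {d'})" using e(1-4) by blast+
    then have "({p, r} \<in> T' \<and> T = insert {q, s} (T' - {{p, r}})) \<or>
        ({q, s} \<in> T' \<and> T = insert {p, r} (T' - {{q, s}}))"
      using e(5) by metis
    then show "flip n T' T" unfolding flip_def using o sides'
      by (intro exI[of _ p] exI[of _ q] exI[of _ r] exI[of _ s] conjI)
    show "T \<noteq> T'" using e(1-4) by blast
  qed
  have "flip n T' T \<and> T \<noteq> T'"
    using T'
  proof (elim disjE conjE)
    assume "{p, r} \<in> T" "T' = insert {q, s} (T - {{p, r}})"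
    with neq[of "{p, r}" "{q, s}"] nb ne(3) show ?thesis by simp
  next
    assume "{q, s} \<in> T" "T' = insert {p, r} (T - {{q, s}})"
    with neq[of "{q, s}" "{p, r}"] nb ne(3)[symmetric] show ?thesis by simp
  qed
  then show "flip n T' T" "T \<noteq> T'" by simp_all
qed

lemma pair_graph_color_graph: "pair_graph (color_graph n c)"
proof -
  have nc: "noncrossing T" if "T \<in> compatible_triangulations n c" for T
    using that by (simp add: compatible_triangulations_def triangulation_def)
  have "finite (parcs (color_graph n c))"
    by (rule finite_subset[where B = "compatible_triangulations n c \<times> compatible_triangulations n c"])
      (auto simp: color_graph_def finite_compatible_triangulations)
  moreover have "symmetric (color_graph n c)"
    using nc flip_sym_neq(1) by (auto simp: symmetric_def color_graph_def intro!: symI)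
  moreover have "fst e \<noteq> snd e" if "e \<in> parcs (color_graph n c)" for e
    using that nc flip_sym_neq(2) by (auto simp: color_graph_def)
  ultimately show ?thesis
    by unfold_locales (auto simp: color_graph_def finite_compatible_triangulations)
qed

lemma pair_graph_hypercube:
  assumes "finite S"
  shows "pair_graph (hypercube S)"
proof -
  have "finite (parcs (hypercube S))"
    by (rule finite_subset[where B = "Pow S \<times> Pow S"]) (auto simp: hypercube_def assms)
  moreover have "symmetric (hypercube S)"
    by (auto simp: symmetric_def hypercube_def Un_commute intro!: symI)
  moreover have "fst e \<noteq> snd e" if "e \<in> parcs (hypercube S)" for e
    using that by (auto simp: hypercube_def)
  moreover have "finite (pverts (hypercube S))"
    by (simp add: hypercube_def assms)
  moreover have "fst e \<in> pverts (hypercube S)" "snd e \<in> pverts (hypercube S)"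
    if "e \<in> parcs (hypercube S)" for e
    using that by (auto simp: hypercube_def)
  ultimately show ?thesis
    by unfold_locales
qed

end

theory Submission
  imports Defs
begin

text \<open>
  Send a compatible triangulation to the set of those of its diagonals that have no end point of
  color \<open>0\<close>. The four vertices of a flipped quadrilateral carry all four colors, so exactly one of
  its two diagonals avoids the color \<open>0\<close> and a flip changes exactly one element of the image.
  Conversely, if a diagonal with an end point \<open>p\<close> of color \<open>0\<close> does not belong to a compatible
  triangulation \<open>T\<close>, it leaves \<open>p\<close> through a triangle of \<open>T\<close> and so crosses the side of that
  triangle opposite to \<open>p\<close>, a diagonal of \<open>T\<close> avoiding \<open>0\<close>. Hence if the image of \<open>T\<close> is
  contained in the image of \<open>T'\<close>, then every diagonal of \<open>T'\<close> outside \<open>T\<close> avoids \<open>0\<close>, so that the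
  images differ by the diagonals in \<open>T' - T\<close>. The map is therefore injective, and since two
  triangulations that differ in a single diagonal are related by a flip, adjacent images come from
  adjacent triangulations.
\<close>

section \<open>Arcs of a polygon\<close>

text \<open>The disjuncts are the linear orders compatible with the cyclic order of \<open>a\<close>, \<open>z\<close>, \<open>b\<close>.\<close>

definition arc :: "nat \<Rightarrow> nat \<Rightarrow> nat \<Rightarrow> nat set" where
  "arc n a b = {z. z < n \<and> (a < z \<and> z < b \<or> z < b \<and> b < a \<or> b < a \<and> a < z)}"

lemma finite_arc: "finite (arc n a b)"
  by (rule finite_subset[of _ "{..<n}"]) (auto simp: arc_def)

lemma arc_cases [consumes 2, case_names same left right]:
  assumes "z \<in> arc n a b" "u \<in> arc n a b"
  obtains "u = z" | "u \<in> arc n a z" | "u \<in> arc n z b"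
  using assms by (force simp: arc_def)

lemma opposite_arcs_cases [consumes 2, case_names a_least u_least b_least v_least]:
  assumes "u \<in> arc n a b" "v \<in> arc n b a"
  obtains "a < u" "u < b" "b < v" | "u < b" "b < v" "v < a"
    | "b < v" "v < a" "a < u" | "v < a" "a < u" "u < b"
  using assms by (force simp: arc_def)

lemma arc_psubset_left:
  assumes "z \<in> arc n a b"
  shows "arc n a z \<subset> arc n a b"
proof -
  have "arc n a z \<subseteq> arc n a b" "z \<notin> arc n a z" using assms by (auto simp: arc_def)
  with assms show ?thesis by blast
qed

lemma arc_psubset_right:
  assumes "z \<in> arc n a b"
  shows "arc n z b \<subset> arc n a b"
proof -
  have "arc n z b \<subseteq> arc n a b" "z \<notin> arc n z b" using assms by (auto simp: arc_def)
  with assms show ?thesis by blast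
qed

lemma opposite_arc_subset:
  assumes "z \<in> arc n a b"
  shows "arc n b a \<subseteq> arc n z a" "arc n b a \<subseteq> arc n b z"
  using assms by (auto simp: arc_def)

lemma arc_Suc_mod_eq_empty: "i < n \<Longrightarrow> arc n i (Suc i mod n) = {}"
  by (auto simp: arc_def mod_Suc split: if_splits)

lemma Suc_mod_in_arc: "arc n a b \<noteq> {} \<Longrightarrow> a < n \<Longrightarrow> Suc a mod n \<in> arc n a b"
  by (auto simp: arc_def mod_Suc)

lemma crossing_commute: "crossing d e \<longleftrightarrow> crossing e d"
  unfolding crossing_def by blast

lemma crossing_irrefl: "\<not> crossing d d"
  unfolding crossing_def by (auto simp: doubleton_eq_iff)

lemma crossing_arcI:
  assumes "u \<in> arc n a b" "v \<in> arc n b a"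
  shows "crossing {a, b} {u, v}"
  using assms
proof (cases rule: opposite_arcs_cases)
  case a_least then show ?thesis
    unfolding crossing_def
    by (intro exI[of _ a] exI[of _ u] exI[of _ b] exI[of _ v]) simp
next
  case u_least then show ?thesis
    unfolding crossing_def
    by (intro exI[of _ u] exI[of _ b] exI[of _ v] exI[of _ a]) (simp add: insert_commute)
next
  case b_least then show ?thesis
    unfolding crossing_def
    by (intro exI[of _ b] exI[of _ v] exI[of _ a] exI[of _ u]) (simp add: insert_commute)
next
  case v_least then show ?thesis
    unfolding crossing_def
    by (intro exI[of _ v] exI[of _ a] exI[of _ u] exI[of _ b]) (simp add: insert_commute)
qed

lemma crossing_arcE:
  assumes "crossing {a, b} d" "d \<subseteq> {..<n}" "a < n" "b < n"
  obtains u v where "d = {u, v}" "u \<in> arc n a b" "v \<in> arc n b a"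
proof -
  obtain p q r s where order: "p < q" "q < r" "r < s"
    and "{a, b} = {p, r} \<and> d = {q, s} \<or> {a, b} = {q, s} \<and> d = {p, r}"
    using assms(1) unfolding crossing_def by blast
  then consider
      (p_to_r) "a = p" "b = r" "d = {q, s}" | (r_to_p) "a = r" "b = p" "d = {s, q}"
    | (q_to_s) "a = q" "b = s" "d = {r, p}" | (s_to_q) "a = s" "b = q" "d = {p, r}"
    by (auto simp: doubleton_eq_iff)
  then show thesis
  proof cases
    case p_to_r with order assms(2) show thesis by (intro that[of q s]) (auto simp: arc_def)
  next
    case r_to_p with order assms(2) show thesis by (intro that[of s q]) (auto simp: arc_def)
  next
    case q_to_s with order assms(2-4) show thesis by (intro that[of r p]) (auto simp: arc_def)
  next
    case s_to_q with order assms(2-4) show thesis by (intro that[of p r]) (auto simp: arc_def)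
  qed
qed

lemma eq_other_diagonal_if_crossing:
  assumes quad: "u \<in> arc n a b" "v \<in> arc n b a"
    and bounds: "a < n" "b < n" "e \<subseteq> {..<n}"
    and sides: "\<not> crossing {a, u} e" "\<not> crossing {u, b} e"
      "\<not> crossing {b, v} e" "\<not> crossing {v, a} e"
    and crossing: "crossing {a, b} e"
  shows "e = {u, v}"
proof -
  obtain x y where e: "e = {x, y}" and x: "x \<in> arc n a b" and y: "y \<in> arc n b a"
    using crossing_arcE[OF crossing bounds(3,1,2)] by blast
  have outer: "y \<in> arc n u a" "y \<in> arc n b u" "x \<in> arc n v b" "x \<in> arc n a v"
    using opposite_arc_subset[OF quad(1)] opposite_arc_subset[OF quad(2)] x y by blast+
  have "x \<notin> arc n a u" "x \<notin> arc n u b"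
    using crossing_arcI[OF _ outer(1)] crossing_arcI[OF _ outer(2)] sides(1,2) e by blast+
  then have "x = u" using arc_cases[OF quad(1) x] by blast
  have "e = {y, x}" using e by blast
  then have "y \<notin> arc n b v" "y \<notin> arc n v a"
    using crossing_arcI[OF _ outer(3)] crossing_arcI[OF _ outer(4)] sides(3,4) by blast+
  then have "y = v" using arc_cases[OF quad(2) y] by blast
  with e \<open>x = u\<close> show ?thesis by simp
qed

section \<open>Edges and triangles of a triangulation\<close>

definition edges :: "nat \<Rightarrow> nat set set \<Rightarrow> nat set set" where
  "edges n T = T \<union> polygon_sides n"

lemma edges_bounded:
  assumes "triangulation n T" "e \<in> edges n T"
  shows "e \<subseteq> {..<n}"
  using assms by (auto simp: edges_def triangulation_def diagonals_def polygon_sides_def)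

lemma polygon_side_not_crossing:
  assumes "e \<in> polygon_sides n" "d \<subseteq> {..<n}"
  shows "\<not> crossing e d"
proof
  obtain i where i: "i < n" "e = {i, Suc i mod n}"
    using assms(1) unfolding polygon_sides_def by blast
  assume "crossing e d"
  then have "crossing {i, Suc i mod n} d" by (simp add: i(2))
  moreover have "Suc i mod n < n" using i(1) by simp
  ultimately obtain u v where "u \<in> arc n i (Suc i mod n)"
    using crossing_arcE[OF _ assms(2) i(1)] by metis
  with i(1) show False by (simp add: arc_Suc_mod_eq_empty)
qed

lemma edges_not_crossing:
  assumes "triangulation n T" "d \<in> edges n T" "e \<in> edges n T"
  shows "\<not> crossing d e"
proof -
  have "noncrossing T" using assms(1) by (simp add: triangulation_def)
  then show ?thesis
    using assms polygon_side_not_crossing[of _ n] edges_bounded[OF assms(1)] crossing_commute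
    unfolding noncrossing_def edges_def by (metis Un_iff)
qed

lemma triangulation_crossed:
  assumes "triangulation n T" "d \<in> diagonals n" "d \<notin> T"
  obtains e where "e \<in> T" "crossing d e"
proof -
  have T: "T \<subseteq> diagonals n" "noncrossing T" using assms(1) by (auto simp: triangulation_def)
  have "\<not> noncrossing (insert d T)"
    using assms T(1) unfolding triangulation_def by blast
  with T(2) have "\<exists>e \<in> T. crossing d e"
    unfolding noncrossing_def using crossing_irrefl crossing_commute by blast
  then show thesis using that by blast
qed

lemma non_edge_crossed:
  assumes T: "triangulation n T"
    and non_edge: "a < n" "b < n" "a \<noteq> b" "{a, b} \<notin> edges n T"
  obtains u v where "u \<in> arc n a b" "v \<in> arc n b a" "{u, v} \<in> T"
proof -
  have "{a, b} \<in> diagonals n" "{a, b} \<notin> T"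
    using non_edge by (auto simp: diagonals_def edges_def)
  then obtain e where e: "e \<in> T" "crossing {a, b} e"
    using triangulation_crossed[OF T] by blast
  moreover have "e \<subseteq> {..<n}" using edges_bounded[OF T] e(1) by (simp add: edges_def)
  ultimately show thesis using crossing_arcE[of a b e n] non_edge that by metis
qed

lemma edge_from_nearest_neighbor:
  assumes T: "triangulation n T" and ab: "{a, b} \<in> edges n T"
    and y: "y \<in> arc n a b" and ay: "{a, y} \<in> edges n T"
    and nearest: "\<And>k. k \<in> arc n y b \<Longrightarrow> {a, k} \<notin> edges n T"
  shows "{y, b} \<in> edges n T"
proof (rule ccontr)
  assume "{y, b} \<notin> edges n T"
  moreover have bounds: "a < n" "b < n" using edges_bounded[OF T ab] by auto
  moreover have "y < n" "y \<noteq> b" using y by (auto simp: arc_def)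
  ultimately obtain k l where k: "k \<in> arc n y b" and l: "l \<in> arc n b y" and "{k, l} \<in> T"
    using non_edge_crossed[OF T] by metis
  then have kl: "{k, l} \<in> edges n T" by (simp add: edges_def)
  have "a \<in> arc n b y" using y bounds by (auto simp: arc_def)
  from this l show False
  proof (cases rule: arc_cases)
    case same
    with nearest[OF k] kl show False by (simp add: insert_commute)
  next
    case left
    have "k \<in> arc n a b" using k arc_psubset_right[OF y] by blast
    then have "crossing {a, b} {k, l}" using left by (rule crossing_arcI)
    then show False using edges_not_crossing[OF T ab kl] by blast
  next
    case right
    moreover have "k \<in> arc n y a" using k y by (auto simp: arc_def)
    ultimately have "crossing {a, y} {l, k}" by (rule crossing_arcI)
    then show False using edges_not_crossing[OF T ay kl] by (simp add: insert_commute)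
  qed
qed

lemma triangle_on_arc:
  assumes T: "triangulation n T" and ab: "{a, b} \<in> edges n T" and nonempty: "arc n a b \<noteq> {}"
  obtains y where "y \<in> arc n a b" "{a, y} \<in> edges n T" "{y, b} \<in> edges n T"
proof -
  define neighbors where "neighbors = {y \<in> arc n a b. {a, y} \<in> edges n T}"
  have "a < n" using edges_bounded[OF T ab] by auto
  moreover from this have "{a, Suc a mod n} \<in> edges n T"
    by (auto simp: edges_def polygon_sides_def)
  ultimately have "neighbors \<noteq> {}"
    using Suc_mod_in_arc nonempty by (auto simp: neighbors_def)
  moreover have "finite neighbors" by (simp add: neighbors_def finite_arc)
  moreover define y where "y = arg_min_on (\<lambda>y. arc n y b) neighbors"
  ultimately have "y \<in> neighbors" and "\<not> (\<exists>k \<in> neighbors. arc n k b \<subset> arc n y b)"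
    using arg_min_if_finite[of neighbors "\<lambda>y. arc n y b"] by simp_all
  then have y: "y \<in> arc n a b" "{a, y} \<in> edges n T"
    and nearest: "\<And>k. k \<in> arc n y b \<Longrightarrow> k \<notin> neighbors"
    using arc_psubset_right by (simp_all add: neighbors_def) blast
  have "{a, k} \<notin> edges n T" if "k \<in> arc n y b" for k
    using nearest[OF that] that arc_psubset_right[OF y(1)] by (auto simp: neighbors_def)
  then have "{y, b} \<in> edges n T" using edge_from_nearest_neighbor[OF T ab y] by blast
  with y show thesis by (rule that)
qed

text \<open>Of all edges that separate \<open>p\<close> from \<open>x\<close>, one closest to \<open>p\<close> spans a triangle with \<open>p\<close>.\<close>

lemma triangle_at_vertex:
  assumes T: "triangulation n T"
    and non_edge: "p < n" "x < n" "p \<noteq> x" "{p, x} \<notin> edges n T"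
  obtains a b where "a \<in> arc n p x" "b \<in> arc n x p"
    "{p, a} \<in> edges n T" "{a, b} \<in> edges n T" "{b, p} \<in> edges n T"
proof -
  define separating where
    "separating = {(a, b). a \<in> arc n p x \<and> b \<in> arc n x p \<and> {a, b} \<in> edges n T}"
  obtain u v where "u \<in> arc n p x" "v \<in> arc n x p" "{u, v} \<in> T"
    by (rule non_edge_crossed[OF T non_edge])
  then have "(u, v) \<in> separating" by (simp add: separating_def edges_def)
  then have "separating \<noteq> {}" by blast
  moreover have "finite separating"
    by (rule finite_subset[of _ "arc n p x \<times> arc n x p"]) (auto simp: separating_def finite_arc)
  moreover obtain a b where ab: "(a, b) = arg_min_on (\<lambda>(a, b). arc n b a) separating"
    by (metis surj_pair)
  ultimately have "(a, b) \<in> separating" and "\<not> (\<exists>(u, v) \<in> separating. arc n v u \<subset> arc n b a)"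
    using arg_min_if_finite[of separating "\<lambda>(a, b). arc n b a"] by (auto simp flip: ab)
  then have closest: "\<And>y. y \<in> arc n b a \<Longrightarrow> (a, y) \<notin> separating \<and> (y, b) \<notin> separating"
    using arc_psubset_left arc_psubset_right by blast
  from \<open>(a, b) \<in> separating\<close>
  have arcs: "a \<in> arc n p x" "b \<in> arc n x p" and edge: "{b, a} \<in> edges n T"
    by (auto simp: separating_def insert_commute)
  then have p: "p \<in> arc n b a" using non_edge by (auto simp: arc_def)
  then obtain y where y: "y \<in> arc n b a" "{b, y} \<in> edges n T" "{y, a} \<in> edges n T"
    using triangle_on_arc[OF T edge] by blast
  from p y(1) have "y = p"
  proof (cases rule: arc_cases)
    case left
    then have "y \<in> arc n x p" using arcs by (auto simp: arc_def)
    then have "(a, y) \<in> separating" using arcs y by (simp add: separating_def insert_commute)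
    with closest y show ?thesis by blast
  next
    case right
    then have "y \<in> arc n p x" using arcs by (auto simp: arc_def)
    then have "(y, b) \<in> separating" using arcs y by (simp add: separating_def insert_commute)
    with closest y show ?thesis by blast
  qed
  then have "{p, a} \<in> edges n T" "{a, b} \<in> edges n T" "{b, p} \<in> edges n T"
    using edge y by (simp_all add: insert_commute)
  with arcs show thesis by (rule that)
qed

section \<open>Flips\<close>

lemma flip_quadrilateralI:
  assumes arcs: "u \<in> arc n a b" "v \<in> arc n b a" and ab: "a < n" "b < n"
    and sides: "{{a, u}, {u, b}, {b, v}, {v, a}} \<subseteq> edges n T"
    and exchange: "{a, b} \<in> T" "T' = insert {u, v} (T - {{a, b}})"
  shows "flip n T T'"
proof -
  have uv: "u < n" "v < n" using arcs by (auto simp: arc_def)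
  from arcs show ?thesis
  proof (cases rule: opposite_arcs_cases)
    case a_least then show ?thesis
      unfolding flip_def using sides exchange ab uv
      by (intro exI[of _ a] exI[of _ u] exI[of _ b] exI[of _ v]) (simp add: edges_def)
  next
    case u_least then show ?thesis
      unfolding flip_def using sides exchange ab uv
      by (intro exI[of _ u] exI[of _ b] exI[of _ v] exI[of _ a])
        (simp add: edges_def insert_commute)
  next
    case b_least then show ?thesis
      unfolding flip_def using sides exchange ab uv
      by (intro exI[of _ b] exI[of _ v] exI[of _ a] exI[of _ u])
        (simp add: edges_def insert_commute)
  next
    case v_least then show ?thesis
      unfolding flip_def using sides exchange ab uv
      by (intro exI[of _ v] exI[of _ a] exI[of _ u] exI[of _ b])
        (simp add: edges_def insert_commute)
  qed
qed

lemma flip_quadrilateralE: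
  assumes "flip n T T'"
  obtains a u b v where "u \<in> arc n a b" "v \<in> arc n b a"
    "{{a, u}, {u, b}, {b, v}, {v, a}} \<subseteq> edges n T"
    "{a, b} \<in> T" "T' = insert {u, v} (T - {{a, b}})"
proof -
  obtain p q r s where order: "p < q" "q < r" "r < s" "s < n"
    and sides: "{{p, q}, {q, r}, {r, s}, {s, p}} \<subseteq> T \<union> polygon_sides n"
    and T': "{p, r} \<in> T \<and> T' = insert {q, s} (T - {{p, r}}) \<or>
             {q, s} \<in> T \<and> T' = insert {p, r} (T - {{q, s}})"
    using assms unfolding flip_def by blast
  from T' show thesis
  proof
    assume "{p, r} \<in> T \<and> T' = insert {q, s} (T - {{p, r}})"
    with order sides show thesis by (intro that[of q p r s]) (auto simp: arc_def edges_def)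
  next
    assume "{q, s} \<in> T \<and> T' = insert {p, r} (T - {{q, s}})"
    with order sides show thesis
      by (intro that[of r q s p]) (auto simp: arc_def edges_def insert_commute)
  qed
qed

lemma diff_singleton_quadrilateral:
  assumes T: "triangulation n T" and T': "triangulation n T'" and diff: "T' - T = {d}"
  obtains a u b v where "a < n" "b < n" "u \<in> arc n a b" "v \<in> arc n b a"
    "{{a, u}, {u, b}, {b, v}, {v, a}} \<subseteq> edges n T" "d = {u, v}"
proof -
  have "d \<in> diagonals n" "d \<in> T'" "d \<notin> T" using diff T' by (auto simp: triangulation_def)
  then obtain e where e: "e \<in> T" "crossing d e" using triangulation_crossed[OF T] by blast
  then have "e \<notin> edges n T'"
    using edges_not_crossing[OF T', of d e] \<open>d \<in> T'\<close> by (auto simp: edges_def)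
  moreover obtain p x where px: "e = {p, x}" "p < n" "x < n" "p \<noteq> x"
    using e(1) T unfolding triangulation_def diagonals_def by blast
  ultimately obtain u v where uv: "u \<in> arc n p x" "v \<in> arc n x p"
    and edges': "{p, u} \<in> edges n T'" "{u, v} \<in> edges n T'" "{v, p} \<in> edges n T'"
    using triangle_at_vertex[OF T'] by metis
  have "crossing e {u, v}" using crossing_arcI[OF uv] px(1) by simp
  then have "{u, v} \<notin> edges n T"
    using edges_not_crossing[OF T] e(1) by (auto simp: edges_def)
  with edges'(2) have "{u, v} \<in> T' - T" by (simp add: edges_def)
  with diff have d: "d = {u, v}" by simp
  have "x \<in> arc n u v" using uv px by (auto simp: arc_def)
  then obtain y where y: "y \<in> arc n u v" "{u, y} \<in> edges n T'" "{y, v} \<in> edges n T'"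
    using triangle_on_arc[OF T' edges'(2)] by blast
  have opposite: "u \<in> arc n p y" "v \<in> arc n y p" "y < n"
    using uv y(1) by (auto simp: arc_def)
  have "{{p, u}, {u, y}, {y, v}, {v, p}} \<subseteq> edges n T' - {d}"
    using edges' y(2,3) opposite d by (auto simp: arc_def doubleton_eq_iff)
  also have "edges n T' - {d} \<subseteq> edges n T" using diff by (auto simp: edges_def)
  finally have "{{p, u}, {u, y}, {y, v}, {v, p}} \<subseteq> edges n T" .
  with px(2) opposite d show thesis by (intro that)
qed

lemma flip_if_diff_singleton:
  assumes T: "triangulation n T" and T': "triangulation n T'" and diff: "T' - T = {d}"
  shows "flip n T T'"
proof -
  obtain a u b v where bounds: "a < n" "b < n" and uv: "u \<in> arc n a b" "v \<in> arc n b a"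
    and sides: "{{a, u}, {u, b}, {b, v}, {v, a}} \<subseteq> edges n T" and d: "d = {u, v}"
    using diff_singleton_quadrilateral[OF assms] by metis
  have eq_if_crossing_d: "e = {a, b}" if e: "e \<in> T" "crossing d e" for e
  proof -
    have "e \<in> edges n T" using e(1) by (simp add: edges_def)
    then have "e \<subseteq> {..<n}" "\<forall>s \<in> edges n T. \<not> crossing s e"
      using edges_bounded[OF T] edges_not_crossing[OF T] by blast+
    moreover have "u < n" "v < n" "b \<in> arc n u v" "a \<in> arc n v u"
      using uv bounds by (auto simp: arc_def)
    ultimately show ?thesis
      using eq_other_diagonal_if_crossing[of b n u v a e] sides e(2) d
      by (simp add: insert_commute)
  qed
  have "d \<in> diagonals n" "d \<in> T'" "d \<notin> T" using diff T' by (auto simp: triangulation_def)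
  then have "{a, b} \<in> T" "{a, b} \<notin> T'"
    using triangulation_crossed[OF T] eq_if_crossing_d T'
    by (metis triangulation_def noncrossing_def)+
  moreover have "e = {a, b}" if e: "e \<in> T" "e \<notin> T'" for e
  proof -
    have "e \<in> diagonals n" using e(1) T by (auto simp: triangulation_def)
    then obtain d' where d': "d' \<in> T'" "crossing e d'"
      using triangulation_crossed[OF T'] e(2) by blast
    then have "d' \<notin> T" using e(1) T by (auto simp: triangulation_def noncrossing_def)
    with d'(1) diff have "d' = d" by blast
    with d'(2) have "crossing d e" using crossing_commute[of e d] by simp
    with e(1) show ?thesis by (rule eq_if_crossing_d)
  qed
  ultimately have "T - T' = {{a, b}}" by blast
  moreover have "T' = (T' - T) \<union> (T - (T - T'))" by blast
  ultimately have "T' = insert {u, v} (T - {{a, b}})" using diff d by simp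
  with uv bounds sides \<open>{a, b} \<in> T\<close> show ?thesis by (rule flip_quadrilateralI)
qed

section \<open>Diagonals avoiding a color\<close>

definition avoiding :: "'a \<Rightarrow> ('b \<Rightarrow> 'a) \<Rightarrow> 'b set set \<Rightarrow> 'b set set" where
  "avoiding k c T = {d \<in> T. k \<notin> c ` d}"

lemma inj_on_edge:
  assumes c: "polygon_coloring n c" and T: "T \<in> compatible_triangulations n c"
    and edge: "e \<in> edges n T"
  shows "inj_on c e"
proof -
  have "inj_on c e" if "e \<in> polygon_sides n"
    using c that unfolding polygon_coloring_def polygon_sides_def
    by (auto simp: inj_on_def)
  moreover have "inj_on c e" if "e \<in> T"
    using T that by (simp add: compatible_triangulations_def)
  ultimately show ?thesis using edge by (auto simp: edges_def)
qed

lemma distinct_klein_eq_UNIV: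
  fixes w x y z :: klein
  assumes "distinct [w, x, y, z]"
  shows "{w, x, y, z} = UNIV"
proof (rule card_eq_UNIV_imp_eq_UNIV)
  have UNIV_klein: "(UNIV :: klein set) = {0, 1} \<times> {0, 1}" using bit.exhaust by auto
  show "finite (UNIV :: klein set)" unfolding UNIV_klein by simp
  show "card {w, x, y, z} = card (UNIV :: klein set)"
    unfolding UNIV_klein using assms by simp
qed

lemma crossed_by_avoiding:
  assumes c: "polygon_coloring n c" and T: "T \<in> compatible_triangulations n c"
    and d: "d \<in> diagonals n" "d \<notin> T" "k \<in> c ` d"
  obtains e where "e \<in> avoiding k c T" "crossing d e"
proof -
  have triangulation: "triangulation n T" using T by (simp add: compatible_triangulations_def)
  obtain p x where px: "d = {p, x}" "p < n" "x < n" "p \<noteq> x" "c p = k"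
    using d(1,3) unfolding diagonals_def by (auto simp: insert_commute)
  then have "{p, x} \<notin> edges n T" using d by (auto simp: edges_def diagonals_def)
  then obtain a b where ab: "a \<in> arc n p x" "b \<in> arc n x p"
    and edges: "{p, a} \<in> edges n T" "{a, b} \<in> edges n T" "{b, p} \<in> edges n T"
    using triangle_at_vertex[OF triangulation px(2-4)] by blast
  have crossing: "crossing d {a, b}" using crossing_arcI[OF ab] px(1) by simp
  moreover have "{a, b} \<in> avoiding k c T"
  proof -
    have "d \<subseteq> {..<n}" using px by simp
    then have "{a, b} \<notin> polygon_sides n"
      using polygon_side_not_crossing crossing crossing_commute by blast
    then have "{a, b} \<in> T" using edges(2) by (simp add: edges_def)
    moreover have "a \<noteq> p" "b \<noteq> p" using ab by (auto simp: arc_def)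
    then have "c a \<noteq> k" "c b \<noteq> k"
      using inj_on_edge[OF c T edges(1)] inj_on_edge[OF c T edges(3)] px(5)
      by (auto simp: inj_on_def)
    ultimately show ?thesis by (auto simp: avoiding_def)
  qed
  ultimately show thesis using that by blast
qed

lemma diff_eq_avoiding_diff:
  assumes c: "polygon_coloring n c" and T: "T \<in> compatible_triangulations n c"
    and T': "triangulation n T'" and subset: "avoiding k c T \<subseteq> avoiding k c T'"
  shows "T' - T = avoiding k c T' - avoiding k c T"
proof
  show "T' - T \<subseteq> avoiding k c T' - avoiding k c T"
  proof
    fix d assume d: "d \<in> T' - T"
    have "k \<notin> c ` d"
    proof
      assume "k \<in> c ` d"
      moreover have "d \<in> diagonals n" using d T' by (auto simp: triangulation_def)
      ultimately obtain e where "e \<in> avoiding k c T" "crossing d e"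
        using crossed_by_avoiding[OF c T] d by blast
      moreover from \<open>e \<in> avoiding k c T\<close> have "e \<in> T'" using subset by (auto simp: avoiding_def)
      ultimately show False using d T' unfolding triangulation_def noncrossing_def by blast
    qed
    with d show "d \<in> avoiding k c T' - avoiding k c T" by (simp add: avoiding_def)
  qed
qed (auto simp: avoiding_def)

lemma avoiding_inj:
  assumes "polygon_coloring n c"
  shows "inj_on (avoiding k c) (compatible_triangulations n c)"
proof (rule inj_onI)
  fix T T' assume T: "T \<in> compatible_triangulations n c" "T' \<in> compatible_triangulations n c"
    and "avoiding k c T = avoiding k c T'"
  then have "T' - T = {}" "T - T' = {}"
    using diff_eq_avoiding_diff[OF assms, of T T' k] diff_eq_avoiding_diff[OF assms, of T' T k]
    by (auto simp: compatible_triangulations_def)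
  then show "T = T'" by blast
qed

lemma sym_diff_avoiding_singleton_if_flip:
  assumes c: "polygon_coloring n c"
    and T: "T \<in> compatible_triangulations n c" and T': "T' \<in> compatible_triangulations n c"
    and flip: "flip n T T'"
  shows "\<exists>d. sym_diff (avoiding k c T) (avoiding k c T') = {d}"
proof -
  obtain a u b v where uv: "u \<in> arc n a b" "v \<in> arc n b a"
    and sides: "{{a, u}, {u, b}, {b, v}, {v, a}} \<subseteq> edges n T"
    and ab: "{a, b} \<in> T" and T'_eq: "T' = insert {u, v} (T - {{a, b}})"
    using flip by (rule flip_quadrilateralE)
  have "inj_on c {a, b}" "inj_on c {u, v}"
    using ab T'_eq T T' by (simp_all add: compatible_triangulations_def del: inj_on_insert)
  moreover have "\<forall>e \<in> {{a, u}, {u, b}, {b, v}, {v, a}}. inj_on c e"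
    using sides inj_on_edge[OF c T] by blast
  moreover have "distinct [a, u, b, v]" using uv by (auto simp: arc_def)
  ultimately have "distinct [c a, c u, c b, c v]" by (auto simp: inj_on_def)
  then have one_diagonal: "k \<in> c ` {a, b} \<longleftrightarrow> k \<notin> c ` {u, v}"
    using distinct_klein_eq_UNIV[of "c a" "c u" "c b" "c v"] by auto
  have "{u, v} \<notin> T"
    using T ab crossing_arcI[OF uv]
    by (auto simp: compatible_triangulations_def triangulation_def noncrossing_def)
  then have "sym_diff (avoiding k c T) (avoiding k c T') =
      {if k \<in> c ` {a, b} then {u, v} else {a, b}}"
    using one_diagonal ab unfolding T'_eq avoiding_def by (auto simp del: image_insert)
  then show ?thesis by blast
qed

lemma flip_iff_sym_diff_avoiding_singleton:
  assumes c: "polygon_coloring n c"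
    and T: "T \<in> compatible_triangulations n c" and T': "T' \<in> compatible_triangulations n c"
  shows "flip n T T' \<longleftrightarrow> (\<exists>d. sym_diff (avoiding k c T) (avoiding k c T') = {d})"
proof
  assume "\<exists>d. sym_diff (avoiding k c T) (avoiding k c T') = {d}"
  then obtain d where d: "sym_diff (avoiding k c T) (avoiding k c T') = {d}" ..
  have triangulations: "triangulation n T" "triangulation n T'"
    using T T' by (simp_all add: compatible_triangulations_def)
  from d consider
      (larger) "avoiding k c T \<subseteq> avoiding k c T'" "avoiding k c T' - avoiding k c T = {d}"
    | (smaller) "avoiding k c T' \<subseteq> avoiding k c T" "avoiding k c T - avoiding k c T' = {d}"
    unfolding Un_singleton_iff Diff_eq_empty_iff by blast
  then show "flip n T T'"
  proof cases
    case larger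
    then have "T' - T = {d}" using diff_eq_avoiding_diff[OF c T triangulations(2)] by blast
    with triangulations show ?thesis by (rule flip_if_diff_singleton)
  next
    case smaller
    then have "T - T' = {d}" using diff_eq_avoiding_diff[OF c T' triangulations(1)] by blast
    then have "flip n T' T" using triangulations by (intro flip_if_diff_singleton)
    then show ?thesis
      using flip_sym_neq(1) triangulations(2) by (simp add: triangulation_def)
  qed
qed (rule sym_diff_avoiding_singleton_if_flip[OF assms])

section \<open>Induced embeddings\<close>

definition induced_embedding ::
    "'a pair_pre_digraph \<Rightarrow> 'b pair_pre_digraph \<Rightarrow> ('a \<Rightarrow> 'b) \<Rightarrow> bool" where
  "induced_embedding G K f \<longleftrightarrow> inj_on f (pverts G) \<and> f ` pverts G \<subseteq> pverts K \<and>
     (\<forall>u \<in> pverts G. \<forall>v \<in> pverts G. (u, v) \<in> parcs G \<longleftrightarrow> (f u, f v) \<in> parcs K)"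

lemma induced_embedding_comp:
  assumes "induced_embedding G K f" "induced_embedding K L g"
  shows "induced_embedding G L (g \<circ> f)"
  using assms unfolding induced_embedding_def
  by (auto simp: image_subset_iff intro: comp_inj_on inj_on_subset)

lemma induced_subgraph_if_induced_embedding:
  assumes "pair_wf_digraph G" "pair_wf_digraph K" and f: "induced_embedding G K f"
  shows "\<exists>H. induced_subgraph H (with_proj K) \<and> digraph_iso (with_proj G) H"
proof (intro exI conjI)
  interpret G: pair_wf_digraph G by fact
  interpret K: pair_wf_digraph K by fact
  let ?H = "with_proj K \<restriction> (f ` pverts G)"
  let ?h = "\<lparr>iso_verts = f, iso_arcs = map_prod f f, iso_head = snd, iso_tail = fst\<rparr>"
  have inj: "inj_on f (pverts G)" and verts: "f ` pverts G \<subseteq> pverts K"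
    and arcs_iff: "\<And>u v. u \<in> pverts G \<Longrightarrow> v \<in> pverts G \<Longrightarrow>
      (u, v) \<in> parcs G \<longleftrightarrow> (f u, f v) \<in> parcs K"
    using f unfolding induced_embedding_def by auto
  show "induced_subgraph ?H (with_proj K)" using verts by (intro K.induced_induce) simp
  have arcs: "parcs G \<subseteq> pverts G \<times> pverts G" by (auto dest: G.in_arcsD1 G.in_arcsD2)
  then have "inj_on (map_prod f f) (parcs G)"
    using map_prod_inj_on[OF inj inj] inj_on_subset by blast
  then have "G.digraph_isomorphism ?h"
    unfolding G.digraph_isomorphism_def using inj G.wf_digraph_axioms by auto
  moreover have "parcs G = {(u, v). u \<in> pverts G \<and> v \<in> pverts G \<and> (f u, f v) \<in> parcs K}"
    using arcs arcs_iff by auto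
  then have "map_prod f f ` parcs G =
      {e \<in> parcs K. fst e \<in> f ` pverts G \<and> snd e \<in> f ` pverts G}"
    by force
  then have "?H = app_iso ?h (with_proj G)"
    by (simp add: induce_subgraph_def app_iso_def)
  ultimately show "digraph_iso (with_proj G) ?H" unfolding digraph_iso_def by blast
qed

lemma induced_embedding_hypercube_image:
  assumes g: "inj_on g S"
  shows "induced_embedding (hypercube S) (hypercube (g ` S)) ((`) g)"
  unfolding induced_embedding_def
proof (intro conjI ballI)
  show "inj_on ((`) g) (pverts (hypercube S))"
    using inj_on_image_Pow[OF g] by (simp add: hypercube_def)
  show "(`) g ` pverts (hypercube S) \<subseteq> pverts (hypercube (g ` S))"
    by (auto simp: hypercube_def)
  fix A B assume "A \<in> pverts (hypercube S)" "B \<in> pverts (hypercube S)"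
  then have AB: "A \<subseteq> S" "B \<subseteq> S" by (simp_all add: hypercube_def)
  then have "sym_diff (g ` A) (g ` B) = g ` sym_diff A B"
    using inj_on_image_set_diff[OF g, of A B] inj_on_image_set_diff[OF g, of B A]
    by (simp add: image_Un le_supI1 subset_trans[OF Diff_subset])
  moreover have "inj_on g (sym_diff A B)" using AB by (auto intro: inj_on_subset[OF g])
  then have "card (g ` sym_diff A B) = card (sym_diff A B)" by (rule card_image)
  ultimately have "is_singleton (sym_diff (g ` A) (g ` B)) \<longleftrightarrow> is_singleton (sym_diff A B)"
    by (simp add: is_singleton_altdef)
  then show "(A, B) \<in> parcs (hypercube S) \<longleftrightarrow> (g ` A, g ` B) \<in> parcs (hypercube (g ` S))"
    using AB by (auto simp: hypercube_def is_singleton_def)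
qed

lemma induced_embedding_avoiding:
  assumes c: "polygon_coloring n c"
  shows "induced_embedding (color_graph n c) (hypercube (diagonals n)) (avoiding k c)"
proof -
  have "avoiding k c T \<subseteq> diagonals n" if "T \<in> compatible_triangulations n c" for T
    using that by (auto simp: avoiding_def compatible_triangulations_def triangulation_def)
  then show ?thesis
    using avoiding_inj[OF c] flip_iff_sym_diff_avoiding_singleton[OF c]
    by (auto simp: induced_embedding_def color_graph_def hypercube_def)
qed

theorem theorem2:
  fixes n :: nat and c :: "nat \<Rightarrow> klein"
  assumes "n \<ge> 3" and "polygon_coloring n c"
  shows "\<exists>(S :: nat set) H. finite S \<and>
           induced_subgraph H (with_proj (hypercube S)) \<and>
           digraph_iso (with_proj (color_graph n c)) H"
proof -
  obtain g :: "nat set \<Rightarrow> nat" where g: "inj_on g (diagonals n)"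
    using finite_imp_inj_to_nat_seg[OF finite_diagonals] by blast
  have "finite (g ` diagonals n)" by (simp add: finite_diagonals)
  interpret color_graph: pair_graph "color_graph n c" by (rule pair_graph_color_graph)
  interpret cube: pair_graph "hypercube (g ` diagonals n)"
    by (rule pair_graph_hypercube) fact
  have "induced_embedding (color_graph n c) (hypercube (g ` diagonals n))
      ((`) g \<circ> avoiding 0 c)"
    using induced_embedding_avoiding[OF assms(2)] induced_embedding_hypercube_image[OF g]
    by (rule induced_embedding_comp)
  then show ?thesis
    using induced_subgraph_if_induced_embedding color_graph.pair_wf_digraph_axioms
      cube.pair_wf_digraph_axioms \<open>finite (g ` diagonals n)\<close> by blast
qed

end
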